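(* Every $\mathbf{S}_4$ ball space is an $\mathbf{S}_4^d$ ball space.
   Context: A ball space $(X,\mathcal{B})$ consists of a nonempty set $X$ and a nonempty family $\mathcal{B}$ of nonempty subsets of $X$, called balls. A nest of balls is a nonempty subset of $\mathcal{B}$ which is totally ordered by inclusion. A directed system of balls is a nonempty collection of balls such that the intersection of any two balls in the collection contains a ball included in the collection. $(X,\mathcal{B})$ is an $\mathbf{S}_4$ ball space if the intersection of each nest of balls contains a largest ball, i.e. a ball $B\in\mathcal{B}$ contained in the intersection such that every ball contained in the intersection is contained in $B$. It is an $\mathbf{S}_4^d$ ball space if the intersection of each directed system of balls contains a largest ball. *)

theory Defs
  imports Main
begin

definition ball_space :: "'a set \<Rightarrow> 'a set set \<Rightarrow> bool" where
  "ball_space X \<B> \<longleftrightarrow> X \<noteq> {} \<and> \<B> \<noteq> {} \<and> (\<forall>B\<in>\<B>. B \<noteq> {} \<and> B \<subseteq> X)"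

definition nest_of_balls :: "'a set set \<Rightarrow> 'a set set \<Rightarrow> bool" where
  "nest_of_balls \<B> N \<longleftrightarrow> N \<noteq> {} \<and> N \<subseteq> \<B> \<and> chain\<^sub>\<subseteq> N"

definition directed_system_of_balls :: "'a set set \<Rightarrow> 'a set set \<Rightarrow> bool" where
  "directed_system_of_balls \<B> D \<longleftrightarrow>
     D \<noteq> {} \<and> D \<subseteq> \<B> \<and> (\<forall>A\<in>D. \<forall>B\<in>D. \<exists>C\<in>D. C \<subseteq> A \<inter> B)"

definition contains_largest_ball :: "'a set set \<Rightarrow> 'a set \<Rightarrow> bool" where
  "contains_largest_ball \<B> S \<longleftrightarrow>
     (\<exists>B\<in>\<B>. B \<subseteq> S \<and> (\<forall>B'\<in>\<B>. B' \<subseteq> S \<longrightarrow> B' \<subseteq> B))"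

definition S4_ball_space :: "'a set \<Rightarrow> 'a set set \<Rightarrow> bool" where
  "S4_ball_space X \<B> \<longleftrightarrow>
     ball_space X \<B> \<and> (\<forall>N. nest_of_balls \<B> N \<longrightarrow> contains_largest_ball \<B> (\<Inter>N))"

definition S4d_ball_space :: "'a set \<Rightarrow> 'a set set \<Rightarrow> bool" where
  "S4d_ball_space X \<B> \<longleftrightarrow>
     ball_space X \<B> \<and> (\<forall>D. directed_system_of_balls \<B> D \<longrightarrow> contains_largest_ball \<B> (\<Inter>D))"

end

theory Submission
  imports Defs
begin

text \<open>
  Ordered by reverse inclusion, the balls form a poset, and the largest ball contained in the
  intersection of a family of balls is the supremum of that family.  The theorem is thus the classical
  fact, due to Iwamura and Markowsky, that a poset with suprema of nonempty chains has suprema of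
  directed sets.

  Suprema over larger and larger sets are built by induction on cardinality.  Splitting the directed
  system \<open>D\<close> itself into a chain of smaller directed subsystems would need a closure operation and
  an estimate of its cardinality, and would single out the countable case.  It is simpler to index by
  finite sets first: \<open>directed_system_finite_indexing\<close> yields balls \<open>f F\<close> in \<open>D\<close> for the finite
  \<open>F \<subseteq> D\<close>, shrinking as \<open>F\<close> grows, with \<open>f F \<subseteq> \<Inter>F\<close>.  For every \<open>A \<subseteq> D\<close> the balls \<open>f F\<close> with
  finite \<open>F \<subseteq> A\<close> then form a directed system, which has the smallest ball \<open>f A\<close> if \<open>A\<close> is finite.
  If \<open>A\<close> is infinite, it is the union of a chain of subsets of smaller cardinality
  (\<open>infinite_chain_of_smaller_subsets\<close>); the largest balls obtained for these subsets form a nest, to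
  which the hypothesis applies (\<open>S4_contains_largest_ball_chain_Inter\<close>).  The case \<open>A = D\<close> is the
  theorem, because each \<open>B\<close> in \<open>D\<close> contains \<open>f {B}\<close>.
\<close>

text \<open>
  With \<open>\<Inter>\<close> of the empty family equal to \<open>UNIV\<close>, the empty case is the nonemptiness of \<open>D\<close>.
\<close>

lemma directed_system_finite_lower_bound:
  assumes D: "directed_system_of_balls \<B> D" and "finite F" "F \<subseteq> D"
  shows "\<exists>C\<in>D. C \<subseteq> \<Inter>F"
  using assms(2,3)
proof (induction F)
  case empty
  then show ?case
    using D by (auto simp: directed_system_of_balls_def)
next
  case (insert A F)
  then obtain C where "C \<in> D" "C \<subseteq> \<Inter>F"
    by auto
  moreover obtain E where "E \<in> D" "E \<subseteq> A \<inter> C"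
    using D insert.prems \<open>C \<in> D\<close> unfolding directed_system_of_balls_def by blast
  ultimately show ?case
    by blast
qed

text \<open>
  By recursion on the finite set \<open>F\<close>: choose \<open>f F\<close> in \<open>D\<close> below the finitely many members of \<open>F\<close>
  and the finitely many balls already chosen for the proper subsets of \<open>F\<close>.
\<close>

lemma directed_system_finite_indexing:
  assumes D: "directed_system_of_balls \<B> D"
  obtains f where
    "\<And>F. finite F \<Longrightarrow> F \<subseteq> D \<Longrightarrow> f F \<in> D \<and> f F \<subseteq> \<Inter>F"
    "\<And>F G. finite F \<Longrightarrow> F \<subseteq> D \<Longrightarrow> G \<subseteq> F \<Longrightarrow> f F \<subseteq> f G"
proof -
  define P where "P f F C \<longleftrightarrow>
    (finite F \<and> F \<subseteq> D \<longrightarrow> C \<in> D \<and> C \<subseteq> \<Inter>F \<and> (\<forall>G. G \<subset> F \<longrightarrow> C \<subseteq> f G))"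
    for f :: "'a set set \<Rightarrow> 'a set" and F C
  have "\<exists>f. \<forall>F. P f F (f F)"
  proof (rule dependent_wf_choice)
    show "wf (finite_psubset :: ('a set set \<times> 'a set set) set)"
      by (rule wf_finite_psubset)
  next
    fix f g :: "'a set set \<Rightarrow> 'a set" and F C
    assume "\<And>G. (G, F) \<in> finite_psubset \<Longrightarrow> f G = g G"
    then show "P f F C = P g F C"
      unfolding P_def finite_psubset_def by auto
  next
    fix F and f :: "'a set set \<Rightarrow> 'a set"
    assume IH: "\<And>G. (G, F) \<in> finite_psubset \<Longrightarrow> P f G (f G)"
    show "\<exists>C. P f F C"
    proof (cases "finite F \<and> F \<subseteq> D")
      case True
      have "f G \<in> D" if "G \<subset> F" for G
        using IH[of G] that True finite_subset[of G F] unfolding P_def finite_psubset_def by auto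
      then have "F \<union> f ` {G. G \<subset> F} \<subseteq> D"
        using True by auto
      moreover have "finite {G. G \<subset> F}"
        using True by (auto intro: finite_subset[of _ "Pow F"])
      ultimately obtain C where "C \<in> D" "C \<subseteq> \<Inter>(F \<union> f ` {G. G \<subset> F})"
        using directed_system_finite_lower_bound[OF D, of "F \<union> f ` {G. G \<subset> F}"] True by auto
      then show ?thesis
        unfolding P_def by (intro exI[of _ C]) auto
    qed (auto simp: P_def)
  qed
  then obtain f where f: "\<And>F. P f F (f F)"
    by blast
  show thesis
  proof (rule that)
    show "f F \<in> D \<and> f F \<subseteq> \<Inter>F" if "finite F" "F \<subseteq> D" for F
      using f[of F] that unfolding P_def by auto
    show "f F \<subseteq> f G" if "finite F" "F \<subseteq> D" "G \<subseteq> F" for F G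
      using f[of F] that unfolding P_def by (cases "G = F") auto
  qed
qed

text \<open>
  The initial segments of a well-order of \<open>A\<close> of minimal type are smaller than \<open>A\<close>; they cover
  \<open>A\<close> because that type, being infinite, is a limit.
\<close>

lemma infinite_chain_of_smaller_subsets:
  assumes "infinite A"
  obtains \<C> where "\<C> \<noteq> {}" "chain\<^sub>\<subseteq> \<C>" "\<Union>\<C> = A"
    "\<And>C. C \<in> \<C> \<Longrightarrow> (card_of C, card_of A) \<in> ordLess"
proof -
  let ?r = "card_of A"
  let ?\<C> = "underS ?r ` A"
  have card: "Card_order ?r" and field: "Field ?r = A"
    by (rule card_of_Card_order, rule Field_card_of)
  then have "Well_order ?r"
    by (simp add: card_order_on_def)
  then have "trans ?r" "antisym ?r" and total: "total_on A ?r"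
    using field by (auto simp: order_on_defs)
  then have mono: "underS ?r a \<subseteq> underS ?r b" if "(a, b) \<in> ?r" for a b
    using that by (intro underS_incr)
  show thesis
  proof
    show "?\<C> \<noteq> {}"
      using assms by auto
    show "chain\<^sub>\<subseteq> ?\<C>"
      unfolding chain_subset_def ball_simps
    proof (intro ballI)
      fix a b assume "a \<in> A" "b \<in> A"
      then consider "a = b" | "(a, b) \<in> ?r" | "(b, a) \<in> ?r"
        using total unfolding total_on_def by blast
      then show "underS ?r a \<subseteq> underS ?r b \<or> underS ?r b \<subseteq> underS ?r a"
        using mono by cases auto
    qed
    have "A \<subseteq> \<Union>?\<C>"
    proof
      fix a assume "a \<in> A"
      then obtain b where "b \<in> A" "a \<noteq> b" "(a, b) \<in> ?r"
        using infinite_Card_order_limit[OF card] assms field by auto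
      then show "a \<in> \<Union>?\<C>"
        by (auto simp: underS_def)
    qed
    moreover have "\<Union>?\<C> \<subseteq> A"
      using field by (auto simp: underS_def Field_def)
    ultimately show "\<Union>?\<C> = A"
      by blast
    show "(card_of C, ?r) \<in> ordLess" if "C \<in> ?\<C>" for C
      using that card_of_underS[OF card] field by auto
  qed
qed

text \<open>
  The largest balls in the members of the chain form a nest, and a ball is contained in \<open>\<Inter>\<S>\<close>
  exactly if it is contained in every ball of that nest.
\<close>

lemma S4_contains_largest_ball_chain_Inter:
  assumes S4: "S4_ball_space X \<B>" and "\<S> \<noteq> {}" "chain\<^sub>\<subseteq> \<S>"
    and largest: "\<And>S. S \<in> \<S> \<Longrightarrow> contains_largest_ball \<B> S"
  shows "contains_largest_ball \<B> (\<Inter>\<S>)"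
proof -
  have "\<exists>b. \<forall>S\<in>\<S>. b S \<in> \<B> \<and> b S \<subseteq> S \<and> (\<forall>B\<in>\<B>. B \<subseteq> S \<longrightarrow> B \<subseteq> b S)"
    using largest unfolding contains_largest_ball_def by (intro bchoice) blast
  then obtain b where b: "\<And>S. S \<in> \<S> \<Longrightarrow> b S \<in> \<B>" "\<And>S. S \<in> \<S> \<Longrightarrow> b S \<subseteq> S"
    "\<And>S B. S \<in> \<S> \<Longrightarrow> B \<in> \<B> \<Longrightarrow> B \<subseteq> S \<Longrightarrow> B \<subseteq> b S"
    by metis
  have "b S \<subseteq> b T" if "S \<in> \<S>" "T \<in> \<S>" "S \<subseteq> T" for S T
    using b that by (meson order_trans)
  then have "nest_of_balls \<B> (b ` \<S>)"
    using assms(2,3) b(1) unfolding nest_of_balls_def chain_subset_def ball_simps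
    by (meson image_is_empty image_subsetI)
  then have "contains_largest_ball \<B> (\<Inter>(b ` \<S>))"
    using S4 unfolding S4_ball_space_def by simp
  then obtain B where "B \<in> \<B>" "B \<subseteq> \<Inter>(b ` \<S>)"
    and max: "\<And>B'. B' \<in> \<B> \<Longrightarrow> B' \<subseteq> \<Inter>(b ` \<S>) \<Longrightarrow> B' \<subseteq> B"
    unfolding contains_largest_ball_def by metis
  moreover have "B \<subseteq> \<Inter>\<S>"
    using \<open>B \<subseteq> \<Inter>(b ` \<S>)\<close> b(2) by (auto simp: subset_iff)
  moreover have "B' \<subseteq> B" if "B' \<in> \<B>" "B' \<subseteq> \<Inter>\<S>" for B'
    using that b(3) by (intro max) (auto simp: subset_iff)
  ultimately show ?thesis
    unfolding contains_largest_ball_def by metis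
qed

text \<open>
  Induction on the cardinality of \<open>A\<close>.  If \<open>A\<close> is finite, the intersection is the ball \<open>f A\<close>
  itself.  If \<open>A\<close> is infinite, it is the union of a chain of smaller sets; a finite subset of \<open>A\<close>
  already lies in a member of the chain, so the intersection for \<open>A\<close> is the intersection of the
  chain of those for the members.
\<close>

lemma S4_contains_largest_ball_finite_subsets:
  fixes f :: "'b set \<Rightarrow> 'a set"
  assumes S4: "S4_ball_space X \<B>"
    and ball: "\<And>F. finite F \<Longrightarrow> F \<subseteq> A \<Longrightarrow> f F \<in> \<B>"
    and mono: "\<And>F G. finite F \<Longrightarrow> F \<subseteq> A \<Longrightarrow> G \<subseteq> F \<Longrightarrow> f F \<subseteq> f G"
  shows "contains_largest_ball \<B> (\<Inter>F\<in>{F. finite F \<and> F \<subseteq> A}. f F)"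
  using ball mono
proof (induction A rule: wf_induct_rule[OF wf_inv_image[OF wf_ordLess, of card_of]])
  case (1 A)
  define I where "I C = (\<Inter>F\<in>{F. finite F \<and> F \<subseteq> C}. f F)" for C
  have "contains_largest_ball \<B> (I A)"
  proof (cases "finite A")
    case True
    then have "I A = f A" "f A \<in> \<B>"
      using 1(2,3) unfolding I_def by auto
    then show ?thesis
      unfolding contains_largest_ball_def by auto
  next
    case False
    then obtain \<C> where \<C>: "\<C> \<noteq> {}" "chain\<^sub>\<subseteq> \<C>" "\<Union>\<C> = A"
      and smaller: "\<And>C. C \<in> \<C> \<Longrightarrow> (card_of C, card_of A) \<in> ordLess"
      by (rule infinite_chain_of_smaller_subsets) blast
    have "contains_largest_ball \<B> (I C)" if "C \<in> \<C>" for C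
      unfolding I_def
    proof (rule 1(1))
      show "(C, A) \<in> inv_image ordLess card_of"
        using smaller that by simp
      have "C \<subseteq> A"
        using that \<C>(3) by blast
      then show "f F \<in> \<B>" if "finite F" "F \<subseteq> C" for F
        using 1(2) that by blast
      show "f F \<subseteq> f G" if "finite F" "F \<subseteq> C" "G \<subseteq> F" for F G
        using 1(3) that \<open>C \<subseteq> A\<close> by blast
    qed
    moreover have antimono: "I D \<subseteq> I C" if "C \<subseteq> D" for C D
      using that unfolding I_def by (intro INF_superset_mono) auto
    then have "chain\<^sub>\<subseteq> (I ` \<C>)"
      using \<C>(2) unfolding chain_subset_def ball_simps by meson
    ultimately have "contains_largest_ball \<B> (\<Inter>(I ` \<C>))"
      using \<C>(1) by (intro S4_contains_largest_ball_chain_Inter[OF S4]) auto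
    moreover have "\<Inter>(I ` \<C>) \<subseteq> f F" if F: "finite F" "F \<subseteq> A" for F
    proof -
      obtain C where "C \<in> \<C>" "F \<subseteq> C"
        using finite_subset_Union_chain[of F \<C> UNIV] F \<C>
        by (auto simp: subset_chain_def chain_subset_def)
      then have "I C \<subseteq> f F"
        using F(1) unfolding I_def by auto
      then show ?thesis
        using \<open>C \<in> \<C>\<close> by (rule INF_lower2[rotated])
    qed
    then have "\<Inter>(I ` \<C>) \<subseteq> I A"
      unfolding I_def[of A] by (intro INT_greatest) auto
    moreover have "I A \<subseteq> \<Inter>(I ` \<C>)"
      using \<C>(3) by (intro INT_greatest antimono) auto
    ultimately show ?thesis
      by (simp add: subset_antisym)
  qed
  then show ?case
    unfolding I_def .
qed

theorem corollary4p3: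
  fixes X :: "'a set" and \<B> :: "'a set set"
  assumes "S4_ball_space X \<B>"
  shows "S4d_ball_space X \<B>"
  unfolding S4d_ball_space_def
proof (intro conjI allI impI)
  show "ball_space X \<B>"
    using assms unfolding S4_ball_space_def by blast
next
  fix D assume D: "directed_system_of_balls \<B> D"
  then obtain f where f: "\<And>F. finite F \<Longrightarrow> F \<subseteq> D \<Longrightarrow> f F \<in> D \<and> f F \<subseteq> \<Inter>F"
    and mono: "\<And>F G. finite F \<Longrightarrow> F \<subseteq> D \<Longrightarrow> G \<subseteq> F \<Longrightarrow> f F \<subseteq> f G"
    by (rule directed_system_finite_indexing) blast
  have "f F \<in> \<B>" if "finite F" "F \<subseteq> D" for F
    using f[OF that] D unfolding directed_system_of_balls_def by blast
  then have "contains_largest_ball \<B> (\<Inter>F\<in>{F. finite F \<and> F \<subseteq> D}. f F)"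
    using mono by (rule S4_contains_largest_ball_finite_subsets[OF assms])
  moreover have "(\<Inter>F\<in>{F. finite F \<and> F \<subseteq> D}. f F) = \<Inter>D"
  proof (intro equalityI INT_greatest Inter_greatest)
    \<comment> \<open>A member \<open>B\<close> of \<open>D\<close> contains \<open>f {B}\<close>, so the balls \<open>f F\<close> are cofinal in \<open>D\<close>.\<close>
    show "(\<Inter>F\<in>{F. finite F \<and> F \<subseteq> D}. f F) \<subseteq> B" if "B \<in> D" for B
      using f[of "{B}"] that by auto
    show "\<Inter>D \<subseteq> f F" if "F \<in> {F. finite F \<and> F \<subseteq> D}" for F
      using f[of F] that by auto
  qed
  ultimately show "contains_largest_ball \<B> (\<Inter>D)"
    by simp
qed

end
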